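(* Let $Z^{(1)}(\tau,z)$ and $Z^{(2)}(\tau,z)$ be two elliptic genera (in the sense of the context) with the same data $\hat c=\mathcal{D}-2\delta/h$ and $h$ (and the same $\mathcal{D},\delta$), with twisted Witten indices $\mathfrak{X}^{(i)}_v$ and $\chi_y$-genera $\chi_y^{(i)}$ ($i=1,2$). For $\tau\in\mathbb{H}$ let $\mathcal{P}=\{s+t\tau\mid (s,t)\in[0,h)^2\}$. Then: (i) If, for a given $\tau\in\mathbb{H}$, $Z^{(1)}(\tau,z)=Z^{(2)}(\tau,z)$ at more than $\hat c h^2$ values of $z$ in $\mathcal{P}$, then $Z^{(1)}(\tau,z)=Z^{(2)}(\tau,z)$ identically in $z\in\mathbb{C}$. (ii) If $\hat c<1$ and $\mathfrak{X}_v^{(1)}=\mathfrak{X}_v^{(2)}$ for all $v\in(\mathbb{Z}/h\mathbb{Z})^2$, then $Z^{(1)}(\tau,z)=Z^{(2)}(\tau,z)$ identically on $\mathbb{H}\times\mathbb{C}$. (iii) If $\hat c<1$ and $\chi_y^{(1)}=\chi_y^{(2)}$, then $Z^{(1)}(\tau,z)=Z^{(2)}(\tau,z)$ identically on $\mathbb{H}\times\mathbb{C}$.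
   Context: Notation: $\mathbf{e}[x]=\exp(2\pi\sqrt{-1}\,x)$; $\mathbb{H}$ is the upper half-plane; $q^a=\mathbf{e}[a\tau]$, $y^a=\mathbf{e}[az]$ for $a\in\mathbb{Q}$. Data: a positive integer $h$ and integers $\mathcal{D},\delta$ such that $\hat c=\mathcal{D}-2\delta/h\ge 0$. An elliptic genus with these data is a holomorphic function $Z$ on $\mathbb{H}\times\mathbb{C}$ with the following properties. (a) $Z(\tau,z)=\sum_{n\ge0}\mathfrak{Z}_n(z)q^n$ with $\mathfrak{Z}_n(z)\in y^{-\hat c/2}\,\mathbb{Z}[y^{1/h},y^{-1/h}]$, and $\mathfrak{Z}_0(z)=y^{-\hat c/2}\chi_y$ with $\chi_y\in\mathbb{Z}[y^{1/h}]$; $\chi_y$ is called the $\chi_y$-genus. (b) $Z\left(\frac{a\tau+b}{c\tau+d},\frac{z}{c\tau+d}\right)=\mathbf{e}\left[\frac{\hat c}{2}\frac{cz^2}{c\tau+d}\right]Z(\tau,z)$ for all $\begin{pmatrix}a&b\\c&d\end{pmatrix}\in \mathrm{SL}_2(\mathbb{Z})$. (c) $Z(\tau,z+r\tau+s)=(-1)^{\hat c(r+s)}\,\mathbf{e}\left[-\frac{\hat c}{2}(r^2\tau+2rz)\right]Z(\tau,z)$ for all $(r,s)\in(h\mathbb{Z})^2$ (note $\hat c h\in\mathbb{Z}$). For $v=(r,s)\in\mathbb{Z}^2$ the twisted elliptic genus is $$Z_{(r,s)}(\tau,z)=(-1)^{\mathcal{D}(r+s+rs)}\,\mathbf{e}\left[\tfrac{\hat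 c}{2}(r^2\tau+2rz+rs)\right]Z(\tau,z+r\tau+s),$$ which depends only on $v$ modulo $(h\mathbb{Z})^2$. (d) Standing assumption: for every $v\in\mathbb{Z}^2$, $\mathfrak{X}_v:=Z_v(\tau,0)$ is independent of $\tau$; it is called the twisted Witten index. *)

theory Defs
  imports
    "HOL-Complex_Analysis.Complex_Analysis"
    "HOL-Computational_Algebra.Polynomial"
    "HOL-Library.Poly_Mapping"
begin

definition upper_half_plane :: "complex set" where
  "upper_half_plane = {\<tau>. Im \<tau> > 0}"

definition cexp2pi :: "complex \<Rightarrow> complex" where
  "cexp2pi x = exp (2 * of_real pi * \<i> * x)"

definition c_hat :: "nat \<Rightarrow> int \<Rightarrow> int \<Rightarrow> real" where
  "c_hat h D \<delta> = of_int D - 2 * of_int \<delta> / of_nat h"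

text \<open>Holomorphy in two variables: at every point of the open set the function has a
  (total) derivative, and that derivative is complex linear.\<close>

definition holomorphic2_on :: "(complex \<Rightarrow> complex \<Rightarrow> complex) \<Rightarrow> (complex \<times> complex) set \<Rightarrow> bool" where
  "holomorphic2_on F U \<longleftrightarrow> open U \<and>
     (\<forall>p\<in>U. \<exists>a b. ((\<lambda>(\<tau>, z). F \<tau> z) has_derivative (\<lambda>(s, t). a * s + b * t)) (at p))"

text \<open>The group ring of the additive group of integers over the integers is the ring of
  integral Laurent polynomials.\<close>

definition laurent_eval :: "(int \<Rightarrow>\<^sub>0 int) \<Rightarrow> complex \<Rightarrow> complex" where
  "laurent_eval p x = (\<Sum>k\<in>Poly_Mapping.keys p. of_int (Poly_Mapping.lookup p k) * x powi k)"

text \<open>With \<open>y\<^sup>a = cexp2pi (a * z)\<close> and \<open>q\<^sup>n = cexp2pi (n * \<tau>)\<close>, the function \<open>Zn n\<close> is the coefficient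
  of \<open>q\<^sup>n\<close>; it lies in \<open>y\<close> to the power \<open>- c_hat / 2\<close> times the Laurent polynomials in
  \<open>y\<close> to the power \<open>1 / h\<close>.\<close>

definition q_expansion ::
  "nat \<Rightarrow> int \<Rightarrow> int \<Rightarrow> (complex \<Rightarrow> complex \<Rightarrow> complex) \<Rightarrow> (nat \<Rightarrow> complex \<Rightarrow> complex) \<Rightarrow> bool" where
  "q_expansion h D \<delta> Z Zn \<longleftrightarrow>
     (\<forall>n. \<exists>p. \<forall>z. Zn n z =
        cexp2pi (- of_real (c_hat h D \<delta>) / 2 * z) * laurent_eval p (cexp2pi (z / of_nat h))) \<and>
     (\<forall>\<tau>\<in>upper_half_plane. \<forall>z. (\<lambda>n. Zn n z * cexp2pi (of_nat n * \<tau>)) sums Z \<tau> z)"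

definition is_chi_y_genus ::
  "nat \<Rightarrow> int \<Rightarrow> int \<Rightarrow> (complex \<Rightarrow> complex \<Rightarrow> complex) \<Rightarrow> int poly \<Rightarrow> bool" where
  "is_chi_y_genus h D \<delta> Z P \<longleftrightarrow>
     (\<exists>Zn. q_expansion h D \<delta> Z Zn \<and>
        (\<forall>z. Zn 0 z = cexp2pi (- of_real (c_hat h D \<delta>) / 2 * z) *
                       poly (map_poly of_int P) (cexp2pi (z / of_nat h))))"

text \<open>The $\chi_y$-genus, as a polynomial in \<open>y\<close> to the power \<open>1 / h\<close>; it is unique by
  \<open>is_chi_y_genus_unique\<close> below.\<close>

definition chi_y_genus ::
  "nat \<Rightarrow> int \<Rightarrow> int \<Rightarrow> (complex \<Rightarrow> complex \<Rightarrow> complex) \<Rightarrow> int poly" where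
  "chi_y_genus h D \<delta> Z = (THE P. is_chi_y_genus h D \<delta> Z P)"

text \<open>In the last clause \<open>c_hat h D \<delta> * (r + s)\<close> is an integer (see
  \<open>c_hat_mult_Ints\<close> below), so that the floor is only a type conversion.\<close>

definition elliptic_genus ::
  "nat \<Rightarrow> int \<Rightarrow> int \<Rightarrow> (complex \<Rightarrow> complex \<Rightarrow> complex) \<Rightarrow> bool" where
  "elliptic_genus h D \<delta> Z \<longleftrightarrow>
     holomorphic2_on Z (upper_half_plane \<times> UNIV) \<and>
     (\<exists>P. is_chi_y_genus h D \<delta> Z P) \<and>
     (\<forall>a b c d :: int. a * d - b * c = 1 \<longrightarrow>
        (\<forall>\<tau>\<in>upper_half_plane. \<forall>z.
           Z ((of_int a * \<tau> + of_int b) / (of_int c * \<tau> + of_int d)) (z / (of_int c * \<tau> + of_int d)) =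
           cexp2pi (of_real (c_hat h D \<delta>) / 2 * (of_int c * z ^ 2 / (of_int c * \<tau> + of_int d))) * Z \<tau> z)) \<and>
     (\<forall>r s :: int. int h dvd r \<longrightarrow> int h dvd s \<longrightarrow>
        (\<forall>\<tau>\<in>upper_half_plane. \<forall>z.
           Z \<tau> (z + of_int r * \<tau> + of_int s) =
           (-1) powi \<lfloor>c_hat h D \<delta> * of_int (r + s)\<rfloor> *
           cexp2pi (- of_real (c_hat h D \<delta>) / 2 * (of_int r ^ 2 * \<tau> + 2 * of_int r * z)) * Z \<tau> z))"

definition twisted_genus ::
  "nat \<Rightarrow> int \<Rightarrow> int \<Rightarrow> (complex \<Rightarrow> complex \<Rightarrow> complex) \<Rightarrow> int \<times> int \<Rightarrow> complex \<Rightarrow> complex \<Rightarrow> complex" where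
  "twisted_genus h D \<delta> Z = (\<lambda>(r, s) \<tau> z.
     (-1) powi (D * (r + s + r * s)) *
     cexp2pi (of_real (c_hat h D \<delta>) / 2 *
         (of_int r ^ 2 * \<tau> + 2 * of_int r * z + of_int r * of_int s)) *
     Z \<tau> (z + of_int r * \<tau> + of_int s))"

definition constant_witten_indices ::
  "nat \<Rightarrow> int \<Rightarrow> int \<Rightarrow> (complex \<Rightarrow> complex \<Rightarrow> complex) \<Rightarrow> bool" where
  "constant_witten_indices h D \<delta> Z \<longleftrightarrow>
     (\<forall>v. \<exists>x. \<forall>\<tau>\<in>upper_half_plane. twisted_genus h D \<delta> Z v \<tau> 0 = x)"

definition witten_index ::
  "nat \<Rightarrow> int \<Rightarrow> int \<Rightarrow> (complex \<Rightarrow> complex \<Rightarrow> complex) \<Rightarrow> int \<times> int \<Rightarrow> complex" where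
  "witten_index h D \<delta> Z v = (THE x. \<forall>\<tau>\<in>upper_half_plane. twisted_genus h D \<delta> Z v \<tau> 0 = x)"

definition fundamental_parallelogram :: "nat \<Rightarrow> complex \<Rightarrow> complex set" where
  "fundamental_parallelogram h \<tau> =
     {of_real s + of_real t * \<tau> | s t :: real. s \<in> {0..<of_nat h} \<and> t \<in> {0..<of_nat h}}"

lemma c_hat_mult_Ints:
  assumes "h > 0" "int h dvd r" "int h dvd s"
  shows "c_hat h D \<delta> * of_int (r + s) \<in> \<int>"
proof -
  from assms obtain k where "r + s = int h * k"
    by (meson dvd_add dvdE)
  then have "c_hat h D \<delta> * of_int (r + s) = of_int ((D * int h - 2 * \<delta>) * k)"
    using assms(1) by (simp add: c_hat_def field_simps)
  then show ?thesis by (metis Ints_of_int)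
qed

lemma cexp2pi_surj:
  assumes "w \<noteq> 0"
  obtains x where "cexp2pi x = w"
proof
  show "cexp2pi (Ln w / (2 * of_real pi * \<i>)) = w"
    using assms by (simp add: cexp2pi_def)
qed

lemma is_chi_y_genus_unique:
  assumes h: "h > 0" and 1: "is_chi_y_genus h D \<delta> Z P" and 2: "is_chi_y_genus h D \<delta> Z P'"
  shows "P = P'"
proof -
  let ?p = "map_poly of_int P :: complex poly" and ?q = "map_poly of_int P' :: complex poly"
  from 1 obtain f where f: "q_expansion h D \<delta> Z f"
    "\<And>z. f 0 z = cexp2pi (- of_real (c_hat h D \<delta>) / 2 * z) * poly ?p (cexp2pi (z / of_nat h))"
    unfolding is_chi_y_genus_def by blast
  from 2 obtain g where g: "q_expansion h D \<delta> Z g"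
    "\<And>z. g 0 z = cexp2pi (- of_real (c_hat h D \<delta>) / 2 * z) * poly ?q (cexp2pi (z / of_nat h))"
    unfolding is_chi_y_genus_def by blast
  have fg: "f 0 z = g 0 z" for z
  proof (rule ccontr)
    assume ne: "f 0 z \<noteq> g 0 z"
    define a where "a n = f n z - g n z" for n
    define b where "b n = (if n = 0 then 0 else a (n - 1))" for n
    have sums: "(\<lambda>n. b n * w ^ n) sums 0" if w: "norm w < 1" for w
    proof (cases "w = 0")
      case True
      then show ?thesis using powser_sums_zero[of b] by (simp add: b_def)
    next
      case False
      then obtain \<tau> where \<tau>: "cexp2pi \<tau> = w" by (rule cexp2pi_surj)
      have "norm w = exp (- (2 * pi * Im \<tau>))"
        by (simp add: \<tau>[symmetric] cexp2pi_def norm_exp_eq_Re)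
      with w have "Im \<tau> > 0" by (simp add: zero_less_mult_iff)
      then have \<tau>H: "\<tau> \<in> upper_half_plane" by (simp add: upper_half_plane_def)
      have pow: "cexp2pi (of_nat n * \<tau>) = w ^ n" for n
        by (simp add: \<tau>[symmetric] cexp2pi_def exp_of_nat_mult[symmetric] mult_ac)
      have "(\<lambda>n. f n z * w ^ n) sums Z \<tau> z" "(\<lambda>n. g n z * w ^ n) sums Z \<tau> z"
        using f(1) g(1) \<tau>H unfolding q_expansion_def pow[symmetric] by blast+
      from sums_diff[OF this] have "(\<lambda>n. a n * w ^ n) sums 0"
        by (simp add: a_def algebra_simps)
      from sums_mult[OF this, of w] have "(\<lambda>n. b (Suc n) * w ^ Suc n) sums 0"
        by (simp add: b_def mult_ac)
      then show ?thesis by (subst (asm) sums_Suc_iff) (simp add: b_def)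
    qed
    show False
    proof (rule powser_0_nonzero[of 1 0 b "\<lambda>_. 0" 1])
      show "\<And>x. norm (x - 0) < 1 \<Longrightarrow> (\<lambda>n. b n * (x - 0) ^ n) sums 0" using sums by simp
      show "b 1 \<noteq> 0" using ne by (simp add: b_def a_def)
      fix s :: real
      assume "0 < s" "\<And>w :: complex. w \<in> cball 0 s - {0} \<Longrightarrow> (0 :: complex) \<noteq> 0"
      from this(2)[of "of_real s"] this(1) show False by auto
    qed auto
  qed
  have "poly (?p - ?q) w = 0" if w: "w \<noteq> 0" for w
  proof -
    from w obtain x where x: "cexp2pi x = w" by (rule cexp2pi_surj)
    have "cexp2pi (of_nat h * x / of_nat h) = w" using h x by simp
    then show ?thesis
      using fg[of "of_nat h * x"] unfolding f(2) g(2) by (simp add: cexp2pi_def)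
  qed
  then have "UNIV - {0} \<subseteq> {w. poly (?p - ?q) w = 0}" by auto
  moreover have "infinite (UNIV - {0 :: complex})"
    using infinite_UNIV_char_0 by simp
  ultimately have "?p - ?q = 0"
    using finite_subset poly_roots_finite by blast
  then have "coeff ?p n = coeff ?q n" for n by simp
  then show ?thesis by (intro poly_eqI) (simp add: coeff_map_poly)
qed

end

theory Submission
  imports Defs "HOL-Library.Periodic_Fun"
begin

text \<open>
  For fixed \<open>\<tau>\<close> the difference \<open>f\<close> of two elliptic genera is quasi-periodic under \<open>h\<close> and \<open>h \<tau>\<close>, so
  \<open>f' / f\<close> is \<open>h\<close>-periodic and changes by the constant \<open>- 2 \<pi> \<i> c h\<close> under \<open>h \<tau>\<close>,
  where \<open>c\<close> is \<open>c_hat\<close>. The argument principle on a fundamental domain then gives exactly \<open>c h\<^sup>2\<close> zeros, with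
  multiplicity, unless \<open>f\<close> vanishes identically. If \<open>c < 1\<close>, it is thus enough that \<open>f\<close> vanishes
  at the \<open>h\<^sup>2\<close> points \<open>r \<tau> + s\<close>, which is what equality of the twisted Witten indices says.
  For equal $\chi_y$-genera, the values at integers \<open>z\<close> do not depend on \<open>\<tau>\<close> and hence are read off
  at the cusp \<open>q = 0\<close>; writing \<open>r \<tau> + s = g (k \<tau> + d)\<close> with \<open>g = gcd r s\<close>,
  a modular transformation with bottom row \<open>(k, d)\<close> moves this point to the integer \<open>g\<close>.
\<close>

section \<open>Zeros of quasi-periodic entire functions\<close>

lemma contour_integral_linepath_translate:
  "contour_integral (linepath (a + c) (b + c)) g = contour_integral (linepath a b) (\<lambda>z. g (z + c))"
proof -
  have "linepath (a + c) (b + c) = (+) c \<circ> linepath a b"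
    by (auto simp: linepath_def fun_eq_iff algebra_simps scaleR_conv_of_real)
  then show ?thesis by (simp add: contour_integral_translate)
qed

text \<open>Modulo \<open>L\<close> the start \<open>b\<close> may be moved to some \<open>c\<close>
  in the first period. The segments from \<open>a\<close> and from \<open>c\<close> then share the
  piece from \<open>c\<close> to \<open>a + L\<close>, and their remaining pieces are translates by
  \<open>L\<close>. Continuity on the one line suffices, so poles of \<open>g\<close> off the line
  do no harm.\<close>

lemma contour_integral_linepath_period:
  fixes g :: "complex \<Rightarrow> complex" and L :: real
  assumes L: "L > 0" and per: "\<And>z. g (z + of_real L) = g z"
    and cont: "continuous_on {z. Im z = Im a} g" and ab: "Im b = Im a"
  shows "contour_integral (linepath b (b + of_real L)) g = contour_integral (linepath a (a + of_real L)) g"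
proof -
  interpret periodic_fun_simple g "of_real L" by standard (rule per)
  define n where "n = \<lfloor>(Re b - Re a) / L\<rfloor>"
  define c where "c = b - of_int n * of_real L"
  have "b = c + of_int n * of_real L" by (simp add: c_def)
  then have "contour_integral (linepath b (b + of_real L)) g
      = contour_integral (linepath (c + of_int n * of_real L) ((c + of_real L) + of_int n * of_real L)) g"
    by (simp add: algebra_simps)
  also have "\<dots> = contour_integral (linepath c (c + of_real L)) g"
    unfolding contour_integral_linepath_translate by (simp add: plus_of_int)
  also have "\<dots> = contour_integral (linepath a (a + of_real L)) g"
  proof -
    have "of_int n \<le> (Re b - Re a) / L" "(Re b - Re a) / L < of_int n + 1"
      unfolding n_def by linarith+
    then have c1: "Re a \<le> Re c" "Re c < Re a + of_real L" and Imc: "Im c = Im a"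
      using L ab by (simp_all add: c_def field_simps)
    have seg: "closed_segment u v \<subseteq> {z. Im z = Im a}" if "Im u = Im a" "Im v = Im a" for u v
      using that by (auto simp: closed_segment_same_Im)
    have con: "continuous_on (closed_segment u v) g" if "Im u = Im a" "Im v = Im a" for u v
      using continuous_on_subset[OF cont seg[OF that]] .
    have "contour_integral (linepath a (a + of_real L)) g
        = contour_integral (linepath a c) g + contour_integral (linepath c (a + of_real L)) g"
      using c1 Imc
      by (intro contour_integral_split_linepath con)
        (auto simp: closed_segment_same_Im closed_segment_eq_real_ivl)
    moreover have "contour_integral (linepath c (c + of_real L)) g
        = contour_integral (linepath c (a + of_real L)) g + contour_integral (linepath (a + of_real L) (c + of_real L)) g"
      using c1 Imc
      by (intro contour_integral_split_linepath con)
        (auto simp: closed_segment_same_Im closed_segment_eq_real_ivl)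
    moreover have "contour_integral (linepath (a + of_real L) (c + of_real L)) g = contour_integral (linepath a c) g"
      unfolding contour_integral_linepath_translate by (simp add: per)
    ultimately show ?thesis by simp
  qed
  finally show ?thesis .
qed

text \<open>Periodicity is applied to the Boolean function \<open>f z = 0\<close>, which yields all
  integer multiples of the periods, negative ones included.\<close>

lemma zero_iff_lattice_translate:
  fixes f :: "complex \<Rightarrow> complex" and L T z :: complex and m n :: int
  assumes "\<And>z. f (z + L) = 0 \<longleftrightarrow> f z = 0" and "\<And>z. f (z + T) = 0 \<longleftrightarrow> f z = 0"
  shows "f (z + of_int m * L + of_int n * T) = 0 \<longleftrightarrow> f z = 0"
proof -
  interpret p: periodic_fun_simple "\<lambda>z. f z = 0" L by standard (rule assms(1))
  interpret q: periodic_fun_simple "\<lambda>z. f z = 0" T by standard (rule assms(2))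
  show ?thesis by (simp add: p.plus_of_int q.plus_of_int)
qed

lemma lattice_translate_into_rectangle:
  fixes L :: real and T z :: complex and x y :: real
  assumes L: "L > 0" and T: "Im T > 0"
  obtains m n :: int where
    "Re (z + of_int m * of_real L + of_int n * T) \<in> {x..<x + L}"
    "Im (z + of_int m * of_real L + of_int n * T) \<in> {y..<y + Im T}"
proof -
  \<comment> \<open>The height is fixed first: \<open>T\<close> may also move the real part, whereas
    the later shift by multiples of the real number \<open>L\<close> keeps the height.\<close>
  define n where "n = - \<lfloor>(Im z - y) / Im T\<rfloor>"
  define w where "w = z + of_int n * T"
  define m where "m = - \<lfloor>(Re w - x) / L\<rfloor>"
  have "- of_int n \<le> (Im z - y) / Im T" "(Im z - y) / Im T < - of_int n + 1"
    unfolding n_def by simp_all linarith?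
  then have "Im (z + of_int m * of_real L + of_int n * T) \<in> {y..<y + Im T}"
    using T by (simp add: field_simps)
  moreover have "- of_int m \<le> (Re w - x) / L" "(Re w - x) / L < - of_int m + 1"
    unfolding m_def by simp_all linarith?
  then have "Re (z + of_int m * of_real L + of_int n * T) \<in> {x..<x + L}"
    using L by (simp add: field_simps w_def)
  ultimately show ?thesis by (rule that[rotated])
qed

text \<open>The zeros are countable, so their projections to both axes miss some real
  number.\<close>

lemma zero_free_lines:
  fixes f :: "complex \<Rightarrow> complex"
  assumes hol: "f holomorphic_on UNIV" and nz: "f w0 \<noteq> 0"
  obtains x y :: real where "\<And>z. Re z = x \<or> Im z = y \<Longrightarrow> f z \<noteq> 0"
proof (cases "\<exists>w. f w = 0")
  case True
  then have "\<not> f constant_on UNIV" using nz by (metis UNIV_I constant_on_def)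
  then have "countable {z. f z = 0}"
    using holomorphic_countable_zeros[OF hol open_UNIV connected_UNIV] by simp
  then have "countable (Re ` {z. f z = 0})" "countable (Im ` {z. f z = 0})" by simp_all
  then have "Re ` {z. f z = 0} \<noteq> UNIV" "Im ` {z. f z = 0} \<noteq> UNIV"
    using uncountable_UNIV_real by metis+
  then obtain x y where "x \<notin> Re ` {z. f z = 0}" "y \<notin> Im ` {z. f z = 0}" by blast
  then show ?thesis by (intro that[of x y]) auto
qed (use that in blast)

text \<open>The number \<open>N\<close> counts with multiplicity the zeros in one period rectangle.
  The points of \<open>S\<close> need not lie in that rectangle; \<open>incong\<close> says that
  they are distinct modulo the lattice, so moving them into it loses none.\<close>

theorem quasi_periodic_zero_count:
  fixes f :: "complex \<Rightarrow> complex" and L :: real and T A B k :: complex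
  assumes hol: "f holomorphic_on UNIV" and nz: "f w0 \<noteq> 0"
    and L: "L > 0" and T: "Im T > 0" and k: "k \<noteq> 0"
    and fL: "\<And>z. f (z + of_real L) = k * f z"
    and fT: "\<And>z. f (z + T) = exp (A * z + B) * f z"
    and S: "finite S" "\<And>z. z \<in> S \<Longrightarrow> f z = 0"
    and incong: "\<And>z z' m n. z \<in> S \<Longrightarrow> z' \<in> S \<Longrightarrow> z' = z + of_int m * of_real L + of_int n * T \<Longrightarrow> z' = z"
  obtains N :: nat where "card S \<le> N" "- A * of_real L = 2 * of_real pi * \<i> * of_nat N"
proof -
  \<comment> \<open>The factor 1 is the weight function in the integrand of
    \<open>argument_principle\<close>.\<close>
  define g where "g z = deriv f z * 1 / f z" for z
  have diff: "(f has_field_derivative deriv f z) (at z)" for z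
    using holomorphic_derivI[OF hol open_UNIV] by simp
  have dL: "deriv f (z + of_real L) = k * deriv f z" for z
  proof -
    have "((\<lambda>z. f (z + of_real L)) has_field_derivative deriv f (z + of_real L) * 1) (at z)"
      by (rule DERIV_chain2[OF diff]) (auto intro!: derivative_eq_intros)
    moreover have "((\<lambda>z. k * f z) has_field_derivative k * deriv f z) (at z)"
      by (rule DERIV_cmult[OF diff])
    ultimately show ?thesis by (simp add: fL DERIV_unique)
  qed
  have dT: "deriv f (z + T) = exp (A * z + B) * (A * f z + deriv f z)" for z
  proof -
    have "((\<lambda>z. f (z + T)) has_field_derivative deriv f (z + T) * 1) (at z)"
      by (rule DERIV_chain2[OF diff]) (auto intro!: derivative_eq_intros)
    moreover have "((\<lambda>z. exp (A * z + B) * f z) has_field_derivative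
        exp (A * z + B) * (A * f z + deriv f z)) (at z)"
      by (auto intro!: derivative_eq_intros diff simp: algebra_simps)
    ultimately show ?thesis by (simp add: fT DERIV_unique)
  qed
  have gL: "g (z + of_real L) = g z" for z using k by (simp add: g_def fL dL)
  have gT: "g (z + T) = g z + A" if "f z \<noteq> 0" for z
    using that by (simp add: g_def fT dT add_divide_distrib)
  have zero_iff: "f (z + of_int m * of_real L + of_int n * T) = 0 \<longleftrightarrow> f z = 0" for z m n
    by (rule zero_iff_lattice_translate) (simp_all add: fL fT k)
  have contg: "continuous_on X g" if "\<And>z. z \<in> X \<Longrightarrow> f z \<noteq> 0" for X
    unfolding g_def using that hol
    by (intro continuous_intros holomorphic_on_imp_continuous_on holomorphic_deriv)
      (auto intro: holomorphic_on_subset holomorphic_deriv[THEN holomorphic_on_subset])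
  \<comment> \<open>The left and bottom sides go on zero-free lines; periodicity of the zero set
    then clears the right and top sides.\<close>
  obtain x y where xy: "\<And>z. Re z = x \<or> Im z = y \<Longrightarrow> f z \<noteq> 0"
    using zero_free_lines[OF hol nz] by blast
  have xy1: "f z \<noteq> 0" if "Re z = x + L" for z
    using zero_iff[of z "-1" 0] xy[of "z - of_real L"] that by auto
  have xy2: "f z \<noteq> 0" if "Im z = y + Im T" for z
    using zero_iff[of z 0 "-1"] xy[of "z - T"] that by auto
  \<comment> \<open>A rectangle of width \<open>L\<close> and height \<open>Im T\<close> is a fundamental domain, too. Its top is the bottom
    translated by \<open>T\<close>, up to a horizontal shift that is immaterial for an \<open>L\<close>-periodic integrand.\<close>
  define a1 a2 a3 a4 where "a1 = Complex x y" and "a2 = Complex (x + L) y"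
    and "a3 = Complex (x + L) (y + Im T)" and "a4 = Complex x (y + Im T)"
  note a_defs = a1_def a2_def a3_def a4_def
  have c12: "continuous_on (closed_segment a1 a2) g" and c23: "continuous_on (closed_segment a2 a3) g"
    and c34: "continuous_on (closed_segment a3 a4) g" and c41: "continuous_on (closed_segment a4 a1) g"
    using xy xy1 xy2
    by (intro contg; force simp: a_defs closed_segment_same_Re closed_segment_same_Im)+
  have c43: "continuous_on (closed_segment a4 a3) g" and c14: "continuous_on (closed_segment a1 a4) g"
    using c34 c41 by (simp_all add: closed_segment_commute)
  have "contour_integral (rectpath a1 a3) g = contour_integral (linepath a1 a2) g
      + contour_integral (linepath a2 a3) g - contour_integral (linepath a4 a3) g
      - contour_integral (linepath a1 a4) g"
  proof -
    have "rectpath a1 a3 = linepath a1 a2 +++ linepath a2 a3 +++ linepath a3 a4 +++ linepath a4 a1"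
      by (simp add: rectpath_def Let_def a_defs)
    then show ?thesis
      using c12 c23 c34 c41
        contour_integral_reverse_linepath[OF c34] contour_integral_reverse_linepath[OF c41]
      by (simp add: contour_integrable_continuous_linepath)
  qed
  moreover have "contour_integral (linepath a2 a3) g = contour_integral (linepath a1 a4) g"
  proof -
    have "a2 = a1 + of_real L" "a3 = a4 + of_real L" by (auto simp: a_defs complex_eq_iff)
    then show ?thesis by (simp only: contour_integral_linepath_translate gL)
  qed
  moreover have "contour_integral (linepath a4 a3) g
      = contour_integral (linepath a1 a2) g + A * of_real L"
  proof -
    have a: "a2 = a1 + of_real L" "a3 = a4 + of_real L" by (auto simp: a_defs complex_eq_iff)
    have "contour_integral (linepath a4 (a4 + of_real L)) g
        = contour_integral (linepath (a1 + T) (a1 + T + of_real L)) g"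
    proof (rule contour_integral_linepath_period[where g = g, OF L gL contg])
      show "f z \<noteq> 0" if "z \<in> {z. Im z = Im (a1 + T)}" for z
        using that by (intro xy2) (simp add: a_defs)
    qed (simp add: a_defs)
    also have "\<dots> = contour_integral (linepath (a1 + T) (a2 + T)) g"
      by (simp add: a algebra_simps)
    also have "\<dots> = contour_integral (linepath a1 a2) (\<lambda>z. g z + A)"
      unfolding contour_integral_linepath_translate
      by (rule contour_integral_eq, rule gT, rule xy) (auto simp: a_defs closed_segment_same_Im)
    also have "\<dots> = contour_integral (linepath a1 a2) g + A * of_real L"
      using c12 by (subst contour_integral_add)
        (auto simp: contour_integrable_continuous_linepath a)
    finally show ?thesis by (simp add: a)
  qed
  ultimately have int: "contour_integral (rectpath a1 a3) g = - A * of_real L" by simp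

  \<comment> \<open>The argument principle wants finitely many zeros in its open domain. The whole
    plane may contain infinitely many, so a bounded box with margin 1 around the rectangle is used.
    The clause \<open>w \<in> {}\<close> in \<open>pz\<close> is the empty set of poles.\<close>
  define U where "U = box (a1 - (1 + \<i>)) (a3 + (1 + \<i>))"
  define pz where "pz = {w \<in> U. f w = 0 \<or> w \<in> {}}"
  define Q where "Q = {z \<in> box a1 a3. f z = 0}"
  have re_le: "Re a1 \<le> Re a3" "Im a1 \<le> Im a3" using L T by (auto simp: a_defs)
  have cb: "cbox a1 a3 \<subseteq> U" by (auto simp: U_def in_box_complex_iff in_cbox_complex_iff)
  have path_nz: "f z \<noteq> 0" if "z \<in> path_image (rectpath a1 a3)" for z
    using that re_le xy xy1 xy2 by (auto simp: path_image_rectpath) (auto simp: a_defs)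
  have wn0: "winding_number (rectpath a1 a3) z = 0" if "z \<notin> cbox a1 a3" for z
    using winding_number_rectpath_outside[OF re_le that] .
  have finpz: "finite pz"
  proof (cases "pz = {}")
    case False
    then obtain w where "f w = 0" by (auto simp: pz_def)
    with nz have "\<not> f constant_on UNIV" by (metis UNIV_I constant_on_def)
    then have "finite {z \<in> cbox (a1 - (1 + \<i>)) (a3 + (1 + \<i>)). f z = 0}"
      by (intro holomorphic_compact_finite_zeros[OF hol]) auto
    then show ?thesis
      by (rule finite_subset[rotated]) (auto simp: pz_def U_def in_box_complex_iff in_cbox_complex_iff)
  qed auto
  have Qpz: "Q \<subseteq> pz" using cb box_subset_cbox[of a1 a3] by (auto simp: Q_def pz_def)
  have "contour_integral (rectpath a1 a3) (\<lambda>x. deriv f x * 1 / f x)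
      = of_real (2 * pi) * \<i> * (\<Sum>p\<in>pz. winding_number (rectpath a1 a3) p * 1 * of_int (zorder f p))"
    unfolding pz_def
  proof (rule argument_principle[where h = "\<lambda>_. 1" and f = f and S = U and poles = "{}" and g = "rectpath a1 a3"])
    show "open U" "connected U" by (auto simp: U_def convex_connected)
    show "f holomorphic_on U - {}" using hol by (rule holomorphic_on_subset) simp
    show "path_image (rectpath a1 a3) \<subseteq> U - {w \<in> U. f w = 0 \<or> w \<in> {}}"
      using path_nz path_image_rectpath_subset_cbox[OF re_le] cb by blast
    show "finite {w \<in> U. f w = 0 \<or> w \<in> {}}" using finpz by (simp add: pz_def)
    show "\<forall>z. z \<notin> U \<longrightarrow> winding_number (rectpath a1 a3) z = 0" using wn0 cb by blast
  qed auto
  \<comment> \<open>The winding number is 1 inside the rectangle and 0 outside, and no zero lies on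
    the boundary.\<close>
  also have "(\<Sum>p\<in>pz. winding_number (rectpath a1 a3) p * 1 * of_int (zorder f p))
      = (\<Sum>p\<in>Q. of_int (zorder f p))"
  proof (rule sum.mono_neutral_cong_right[OF finpz Qpz])
    show "\<forall>i\<in>pz - Q. winding_number (rectpath a1 a3) i * 1 * of_int (zorder f i) = 0"
    proof
      fix i assume i: "i \<in> pz - Q"
      then have "i \<notin> path_image (rectpath a1 a3)" using path_nz by (auto simp: pz_def)
      then have "i \<notin> cbox a1 a3" using i re_le
        by (auto simp: path_image_rectpath_cbox_minus_box Q_def pz_def)
      then show "winding_number (rectpath a1 a3) i * 1 * of_int (zorder f i) = 0" by (simp add: wn0)
    qed
    show "winding_number (rectpath a1 a3) p * 1 * of_int (zorder f p) = of_int (zorder f p)"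
      if "p \<in> Q" for p using that winding_number_rectpath[of p a1 a3] by (simp add: Q_def)
  qed
  finally have A: "- A * of_real L = 2 * of_real pi * \<i> * (\<Sum>p\<in>Q. of_int (zorder f p))"
    using int unfolding g_def by simp
  have ord: "zorder f p > 0" if "p \<in> Q" for p
    using zorder_exist_zero[OF hol open_UNIV connected_UNIV UNIV_I, of p] nz that
    by (auto simp: Q_def)
  have finQ: "finite Q" using finpz Qpz finite_subset by blast
  \<comment> \<open>All orders are positive, so \<open>nat\<close> changes no value and each zero
    contributes at least 1.\<close>
  define N where "N = (\<Sum>p\<in>Q. nat (zorder f p))"
  have "(\<Sum>p\<in>Q. of_int (zorder f p)) = (of_nat N :: complex)"
    unfolding N_def of_nat_sum using ord by (intro sum.cong) (auto simp: less_imp_le)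
  moreover have "card S \<le> N"
  proof -
    \<comment> \<open>A translate lands in the half-open rectangle; being a zero, it avoids the left
      and bottom sides and so lies in the open box.\<close>
    have "\<exists>m n. z + of_int m * of_real L + of_int n * T \<in> Q" if z: "z \<in> S" for z
    proof -
      obtain m n where mn: "Re (z + of_int m * of_real L + of_int n * T) \<in> {x..<x + L}"
        "Im (z + of_int m * of_real L + of_int n * T) \<in> {y..<y + Im T}"
        by (rule lattice_translate_into_rectangle[OF L T])
      have z0: "f (z + of_int m * of_real L + of_int n * T) = 0" using zero_iff S(2)[OF z] by simp
      with xy have "Re (z + of_int m * of_real L + of_int n * T) \<noteq> x" "Im (z + of_int m * of_real L + of_int n * T) \<noteq> y"
        by blast+
      with mn z0 show ?thesis
        by (intro exI[of _ m] exI[of _ n]) (auto simp: Q_def in_box_complex_iff a_defs)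
    qed
    then obtain m n where mn: "\<And>z. z \<in> S \<Longrightarrow> z + of_int (m z) * of_real L + of_int (n z) * T \<in> Q"
      by metis
    have "inj_on (\<lambda>z. z + of_int (m z) * of_real L + of_int (n z) * T) S"
    proof (rule inj_onI)
      fix z z' assume z: "z \<in> S" "z' \<in> S"
        and eq: "z + of_int (m z) * of_real L + of_int (n z) * T = z' + of_int (m z') * of_real L + of_int (n z') * T"
      have "z = z' + of_int (m z' - m z) * of_real L + of_int (n z' - n z) * T"
        using eq by (simp add: algebra_simps)
      from incong[OF z(2,1) this] show "z = z'" .
    qed
    then have "card S \<le> card Q"
      using mn finQ by (intro card_inj_on_le) auto
    also have "card Q = (\<Sum>p\<in>Q. 1)" by simp
    also have "\<dots> \<le> N" unfolding N_def using ord by (intro sum_mono) (force simp: Suc_le_eq)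
    finally show ?thesis .
  qed
  ultimately show ?thesis using A by (intro that[of N]) auto
qed

section \<open>Elliptic genera at a fixed \<open>\<tau>\<close>\<close>

lemma cexp2pi_nonzero [simp]: "cexp2pi x \<noteq> 0"
  by (simp add: cexp2pi_def)

text \<open>Restricting the total derivative to the directions \<open>(0, t)\<close> leaves
  multiplication by the complex number \<open>b\<close>.\<close>

lemma elliptic_genus_holomorphic_slice:
  assumes "elliptic_genus h D \<delta> Z" and "\<tau> \<in> upper_half_plane"
  shows "Z \<tau> holomorphic_on UNIV"
  unfolding holomorphic_on_def
proof
  fix z :: complex
  obtain a b where ab: "((\<lambda>(\<tau>, z). Z \<tau> z) has_derivative (\<lambda>(s, t). a * s + b * t)) (at (\<tau>, z))"
    using assms(1)[unfolded elliptic_genus_def holomorphic2_on_def,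
        THEN conjunct1, THEN conjunct2, THEN bspec, of "(\<tau>, z)"] assms(2) by auto
  have "((\<lambda>w. (\<tau>, w)) has_derivative (\<lambda>t. (0, t))) (at z)"
    by (auto intro!: derivative_eq_intros)
  from has_derivative_compose[OF this ab]
  have "(Z \<tau> has_field_derivative b) (at z)"
    by (simp add: has_field_derivative_def)
  then show "Z \<tau> field_differentiable at z within UNIV"
    by (auto simp: field_differentiable_def)
qed

lemma elliptic_genus_modular:
  assumes "elliptic_genus h D \<delta> Z" and "a * d - b * c = 1" and "\<tau> \<in> upper_half_plane"
  shows "Z ((of_int a * \<tau> + of_int b) / (of_int c * \<tau> + of_int d)) (z / (of_int c * \<tau> + of_int d)) =
    cexp2pi (of_real (c_hat h D \<delta>) / 2 * (of_int c * z ^ 2 / (of_int c * \<tau> + of_int d))) * Z \<tau> z"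
  by (rule assms(1)[unfolded elliptic_genus_def, THEN conjunct2, THEN conjunct2, THEN conjunct1,
        rule_format, OF assms(2,3)])

lemma elliptic_genus_quasi_periodic:
  assumes "elliptic_genus h D \<delta> Z" and "int h dvd r" "int h dvd s" and "\<tau> \<in> upper_half_plane"
  shows "Z \<tau> (z + of_int r * \<tau> + of_int s) = (-1) powi \<lfloor>c_hat h D \<delta> * of_int (r + s)\<rfloor> *
    cexp2pi (- of_real (c_hat h D \<delta>) / 2 * (of_int r ^ 2 * \<tau> + 2 * of_int r * z)) * Z \<tau> z"
  by (rule assms(1)[unfolded elliptic_genus_def, THEN conjunct2, THEN conjunct2, THEN conjunct2,
        rule_format, OF assms(2,3,4)])

text \<open>The coordinates with respect to 1 and \<open>\<tau>\<close> lie in a half-open interval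
  of length \<open>h\<close>, so two of them that differ by a multiple of \<open>h\<close> agree.
  Imaginary parts settle \<open>n\<close>, then real parts settle \<open>m\<close>.\<close>

lemma fundamental_parallelogram_incongruent:
  fixes m n :: int
  assumes "h > 0" "\<tau> \<in> upper_half_plane"
    and "z \<in> fundamental_parallelogram h \<tau>" "z' \<in> fundamental_parallelogram h \<tau>"
    and "z' = z + of_int m * of_nat h + of_int n * (of_nat h * \<tau>)"
  shows "z' = z"
proof -
  obtain s t s' t' where z: "z = of_real s + of_real t * \<tau>" "z' = of_real s' + of_real t' * \<tau>"
    and st: "0 \<le> s" "s < h" "0 \<le> t" "t < h" "0 \<le> s'" "s' < h" "0 \<le> t'" "t' < h"
    using assms(3,4) unfolding fundamental_parallelogram_def by auto
  have Im: "Im \<tau> > 0" using assms(2) by (simp add: upper_half_plane_def)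
  have small: "i = 0" if "\<bar>of_int i * real h\<bar> < h" for i :: int
  proof -
    have "\<bar>real_of_int i\<bar> < 1" using that assms(1) by (simp add: abs_mult)
    then show ?thesis by linarith
  qed
  have "(t' - t - of_int n * h) * Im \<tau> = 0"
    using arg_cong[OF assms(5), of Im] by (simp add: z algebra_simps)
  then have t: "of_int n * real h = t' - t" using Im by simp
  then have "n = 0" using st by (intro small) linarith
  then have "of_int m * real h = s' - s"
    using arg_cong[OF assms(5), of Re] t by (simp add: z algebra_simps)
  then have "m = 0" using st by (intro small) linarith
  with \<open>n = 0\<close> assms(5) show ?thesis by simp
qed

text \<open>Both genera obey the same linear transformation law, hence so does their difference, and
  \<open>quasi_periodic_zero_count\<close> applies with \<open>L = h\<close> and
  \<open>T = h * \<tau>\<close>.\<close>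

lemma elliptic_genus_eq_of_many_points:
  assumes h: "h > 0" and Z1: "elliptic_genus h D \<delta> Z1" and Z2: "elliptic_genus h D \<delta> Z2"
    and \<tau>: "\<tau> \<in> upper_half_plane"
    and S: "finite S" "S \<subseteq> fundamental_parallelogram h \<tau>"
    and card: "real (card S) > c_hat h D \<delta> * (real h)\<^sup>2"
    and eq: "\<And>z. z \<in> S \<Longrightarrow> Z1 \<tau> z = Z2 \<tau> z"
  shows "Z1 \<tau> z = Z2 \<tau> z"
proof (rule ccontr)
  assume neq: "Z1 \<tau> z \<noteq> Z2 \<tau> z"
  define f where "f z = Z1 \<tau> z - Z2 \<tau> z" for z
  \<comment> \<open>The sign depends only on \<open>r + s\<close>, so \<open>\<epsilon>\<close>
    serves both \<open>(0, h)\<close> and \<open>(h, 0)\<close>. \<open>A\<close> and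
    \<open>B\<close> are the exponent of the law for \<open>(h, 0)\<close>, with the sign absorbed
    through \<open>Ln \<epsilon>\<close>.\<close>
  define \<epsilon> :: complex where "\<epsilon> = (-1) powi \<lfloor>c_hat h D \<delta> * of_int (int h)\<rfloor>"
  define A where "A = - (2 * of_real pi * \<i> * of_real (c_hat h D \<delta>) * of_nat h)"
  define B where "B = Ln \<epsilon> - of_real pi * \<i> * of_real (c_hat h D \<delta>) * of_nat h ^ 2 * \<tau>"
  have \<epsilon>: "\<epsilon> \<noteq> 0" by (simp add: \<epsilon>_def)
  have hol: "f holomorphic_on UNIV"
    unfolding f_def by (intro holomorphic_intros elliptic_genus_holomorphic_slice[OF Z1 \<tau>]
      elliptic_genus_holomorphic_slice[OF Z2 \<tau>])
  have fL: "f (z + of_real (real h)) = \<epsilon> * f z" for z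
    using elliptic_genus_quasi_periodic[OF Z1 _ _ \<tau>, of 0 "int h" z]
      elliptic_genus_quasi_periodic[OF Z2 _ _ \<tau>, of 0 "int h" z]
    by (simp add: f_def \<epsilon>_def cexp2pi_def algebra_simps)
  have fT: "f (z + of_nat h * \<tau>) = exp (A * z + B) * f z" for z
  proof -
    have "exp (A * z + B) = exp (Ln \<epsilon>) * cexp2pi (- of_real (c_hat h D \<delta>) / 2 *
        (of_nat h ^ 2 * \<tau> + 2 * of_nat h * z))"
      unfolding cexp2pi_def exp_add[symmetric] A_def B_def by (simp add: algebra_simps)
    moreover have "exp (Ln \<epsilon>) = \<epsilon>" using \<epsilon> by simp
    ultimately show ?thesis
      using elliptic_genus_quasi_periodic[OF Z1 _ _ \<tau>, of "int h" 0 z]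
        elliptic_genus_quasi_periodic[OF Z2 _ _ \<tau>, of "int h" 0 z]
      by (simp add: f_def \<epsilon>_def algebra_simps)
  qed
  obtain N :: nat where N: "card S \<le> N" "- A * of_real (real h) = 2 * of_real pi * \<i> * of_nat N"
  proof (rule quasi_periodic_zero_count[OF hol _ _ _ \<epsilon> fL fT S(1)])
    show "f z \<noteq> 0" using neq by (simp add: f_def)
    show "real h > 0" using h by simp
    show "Im (of_nat h * \<tau>) > 0" using h \<tau> by (simp add: upper_half_plane_def)
    show "f w = 0" if "w \<in> S" for w using eq[OF that] by (simp add: f_def)
    show "z' = z" if "z \<in> S" "z' \<in> S"
      "z' = z + of_int m * of_real (real h) + of_int n * (of_nat h * \<tau>)" for z z' m n
      using that S(2) by (intro fundamental_parallelogram_incongruent[OF h \<tau>, of z z' m n]) auto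
  qed
  from N(2) have "of_real (c_hat h D \<delta> * (real h)\<^sup>2) = (of_real (real N) :: complex)"
    by (simp add: A_def power2_eq_square field_simps)
  then have "c_hat h D \<delta> * (real h)\<^sup>2 = real N" by (simp only: of_real_eq_iff)
  with N(1) card show False by simp
qed

section \<open>Lattice points and twisted Witten indices\<close>

lemma lattice_points_in_fundamental_parallelogram:
  fixes h :: nat
  assumes \<tau>: "\<tau> \<in> upper_half_plane"
  defines "S \<equiv> (\<lambda>(r :: int, s :: int). of_int r * \<tau> + of_int s) ` ({0..<int h} \<times> {0..<int h})"
  shows "finite S" "S \<subseteq> fundamental_parallelogram h \<tau>" "card S = h\<^sup>2"
proof -
  show "finite S" by (simp add: S_def)
  show "S \<subseteq> fundamental_parallelogram h \<tau>"
  proof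
    fix w assume "w \<in> S"
    then obtain r s :: int where rs: "r \<in> {0..<int h}" "s \<in> {0..<int h}"
      and w: "w = of_int r * \<tau> + of_int s" unfolding S_def by auto
    have "w = of_real (of_int s) + of_real (of_int r) * \<tau>" by (simp add: w)
    moreover have "real_of_int s \<in> {0..<of_nat h}" "real_of_int r \<in> {0..<of_nat h}"
      using rs by auto
    ultimately show "w \<in> fundamental_parallelogram h \<tau>"
      unfolding fundamental_parallelogram_def by blast
  qed
  have "inj_on (\<lambda>(r :: int, s :: int). of_int r * \<tau> + of_int s) ({0..<int h} \<times> {0..<int h})"
  proof (rule inj_onI, clarify)
    fix r s r' s' :: int
    assume eq: "of_int r * \<tau> + of_int s = of_int r' * \<tau> + of_int s'"
    have "r = r'" using arg_cong[OF eq, of Im] \<tau> by (simp add: upper_half_plane_def)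
    with eq show "r = r' \<and> s = s'" by simp
  qed
  then show "card S = h\<^sup>2"
    unfolding S_def by (simp add: card_image power2_eq_square)
qed

text \<open>For \<open>c_hat < 1\<close> the \<open>h\<^sup>2\<close> lattice points already exceed
  the bound \<open>c_hat * h\<^sup>2\<close>.\<close>

lemma elliptic_genus_eq_of_lattice_points:
  assumes h: "h > 0" and Z1: "elliptic_genus h D \<delta> Z1" and Z2: "elliptic_genus h D \<delta> Z2"
    and \<tau>: "\<tau> \<in> upper_half_plane" and c: "c_hat h D \<delta> < 1"
    and eq: "\<And>r s :: int. r \<in> {0..<int h} \<Longrightarrow> s \<in> {0..<int h} \<Longrightarrow>
      Z1 \<tau> (of_int r * \<tau> + of_int s) = Z2 \<tau> (of_int r * \<tau> + of_int s)"
  shows "Z1 \<tau> z = Z2 \<tau> z"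
proof (rule elliptic_genus_eq_of_many_points[OF h Z1 Z2 \<tau>
      lattice_points_in_fundamental_parallelogram(1,2)[OF \<tau>]])
  have "c_hat h D \<delta> * (real h)\<^sup>2 < 1 * (real h)\<^sup>2"
    using h c by (intro mult_strict_right_mono) auto
  then show "c_hat h D \<delta> * (real h)\<^sup>2 < real (card
      ((\<lambda>(r :: int, s :: int). of_int r * \<tau> + of_int s) ` ({0..<int h} \<times> {0..<int h})))"
    by (simp add: lattice_points_in_fundamental_parallelogram(3)[OF \<tau>])
qed (use eq in auto)

text \<open>The given \<open>\<tau>\<close> shows that the upper half-plane is inhabited, which
  makes the value picked by \<open>THE\<close> unique.\<close>

lemma twisted_genus_eq_witten_index:
  assumes "constant_witten_indices h D \<delta> Z" and \<tau>: "\<tau> \<in> upper_half_plane"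
  shows "twisted_genus h D \<delta> Z v \<tau> 0 = witten_index h D \<delta> Z v"
proof -
  obtain x where x: "\<forall>\<tau>\<in>upper_half_plane. twisted_genus h D \<delta> Z v \<tau> 0 = x"
    using assms unfolding constant_witten_indices_def by blast
  then have "witten_index h D \<delta> Z v = x"
    unfolding witten_index_def using \<tau> by (intro the_equality) auto
  with x \<tau> show ?thesis by simp
qed

text \<open>The twisting factor is nonzero and the same for both genera.\<close>

lemma twisted_genus_zero_eq_iff:
  "twisted_genus h D \<delta> Z1 (r, s) \<tau> 0 = twisted_genus h D \<delta> Z2 (r, s) \<tau> 0 \<longleftrightarrow>
    Z1 \<tau> (of_int r * \<tau> + of_int s) = Z2 \<tau> (of_int r * \<tau> + of_int s)"
  by (simp add: twisted_genus_def)

text \<open>As \<open>\<tau>\<close> varies, \<open>q\<close> runs through the punctured unit disc,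
  where the power series has the constant value \<open>b\<close>; its limit at \<open>q = 0\<close>
  is \<open>a 0\<close>.\<close>

lemma constant_q_series_eq_constant_term:
  assumes "\<And>\<tau>. \<tau> \<in> upper_half_plane \<Longrightarrow> (\<lambda>n. a n * cexp2pi (of_nat n * \<tau>)) sums b"
  shows "a 0 = b"
proof (rule LIM_unique)
  show "(\<lambda>_ :: complex. b) \<midarrow>0\<rightarrow> a 0"
  proof (rule powser_limit_0_strong[of 1])
    fix q :: complex assume q: "q \<noteq> 0" "norm q < 1"
    obtain \<tau> where \<tau>: "cexp2pi \<tau> = q" using cexp2pi_surj[OF q(1)] .
    have "norm q = exp (- (2 * pi * Im \<tau>))"
      by (simp add: \<tau>[symmetric] cexp2pi_def norm_exp_eq_Re)
    with q have "\<tau> \<in> upper_half_plane"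
      by (simp add: upper_half_plane_def zero_less_mult_iff)
    moreover have "cexp2pi (of_nat n * \<tau>) = q ^ n" for n
      by (simp add: \<tau>[symmetric] cexp2pi_def exp_of_nat_mult[symmetric] mult_ac)
    ultimately show "(\<lambda>n. a n * q ^ n) sums b" using assms[of \<tau>] by simp
  qed simp
qed simp

lemma is_chi_y_genus_chi_y_genus:
  assumes "h > 0" "elliptic_genus h D \<delta> Z"
  shows "is_chi_y_genus h D \<delta> Z (chi_y_genus h D \<delta> Z)"
proof -
  obtain P where P: "is_chi_y_genus h D \<delta> Z P"
    using assms(2) unfolding elliptic_genus_def by blast
  then have "chi_y_genus h D \<delta> Z = P"
    unfolding chi_y_genus_def using is_chi_y_genus_unique[OF assms(1)] by (intro the_equality) blast+
  with P show ?thesis by simp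
qed

lemma elliptic_genus_at_int:
  assumes "constant_witten_indices h D \<delta> Z" and chi: "is_chi_y_genus h D \<delta> Z P"
    and \<tau>: "\<tau> \<in> upper_half_plane"
  shows "Z \<tau> (of_int s) = cexp2pi (- of_real (c_hat h D \<delta>) / 2 * of_int s) *
    poly (map_poly of_int P) (cexp2pi (of_int s / of_nat h))"
proof -
  obtain Zn where Zn: "q_expansion h D \<delta> Z Zn"
    and Zn0: "\<And>z. Zn 0 z = cexp2pi (- of_real (c_hat h D \<delta>) / 2 * z) *
      poly (map_poly of_int P) (cexp2pi (z / of_nat h))"
    using chi unfolding is_chi_y_genus_def by blast
  \<comment> \<open>For the twist \<open>(0, s)\<close> the exponential factor is 1 and only a sign
    independent of \<open>\<tau>\<close> remains, so constancy of the index is constancy of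
    \<open>Z\<close> at \<open>s\<close>.\<close>
  have "Z \<tau>' (of_int s) = Z \<tau> (of_int s)" if \<tau>': "\<tau>' \<in> upper_half_plane" for \<tau>'
    using twisted_genus_eq_witten_index[OF assms(1) \<tau>, of "(0, s)"]
      twisted_genus_eq_witten_index[OF assms(1) \<tau>', of "(0, s)"]
    by (simp add: twisted_genus_def cexp2pi_def)
      (metis mult_cancel_left power_int_eq_0_iff zero_neq_neg_one)
  then have "(\<lambda>n. Zn n (of_int s) * cexp2pi (of_nat n * \<tau>')) sums Z \<tau> (of_int s)"
    if "\<tau>' \<in> upper_half_plane" for \<tau>'
    using Zn that unfolding q_expansion_def by (metis (no_types))
  from constant_q_series_eq_constant_term[OF this] show ?thesis by (simp add: Zn0)
qed

lemma moebius_in_upper_half_plane: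
  assumes "a * d - b * c = (1 :: int)" "\<tau> \<in> upper_half_plane"
  shows "(of_int a * \<tau> + of_int b) / (of_int c * \<tau> + of_int d) \<in> upper_half_plane"
proof -
  let ?w = "of_int c * \<tau> + of_int d"
  \<comment> \<open>This imaginary part has the same sign as that of the quotient.\<close>
  have "Im ((of_int a * \<tau> + of_int b) * cnj ?w) = of_int (a * d - b * c) * Im \<tau>"
    by (simp add: algebra_simps)
  moreover have "?w \<noteq> 0"
    using assms by (auto simp: complex_eq_iff upper_half_plane_def)
  ultimately show ?thesis
    using assms by (simp add: upper_half_plane_def Im_complex_div_gt_0)
qed

lemma elliptic_genus_eq_at_lattice_points:
  fixes r s :: int
  assumes Z1: "elliptic_genus h D \<delta> Z1" and Z2: "elliptic_genus h D \<delta> Z2"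
    and eq: "\<And>\<tau> n. \<tau> \<in> upper_half_plane \<Longrightarrow> Z1 \<tau> (of_int n) = Z2 \<tau> (of_int n)"
    and \<tau>: "\<tau> \<in> upper_half_plane"
  shows "Z1 \<tau> (of_int r * \<tau> + of_int s) = Z2 \<tau> (of_int r * \<tau> + of_int s)"
proof (cases "r = 0 \<and> s = 0")
  case True
  then show ?thesis using eq[OF \<tau>, of 0] by simp
next
  case False
  \<comment> \<open>Excluding the origin makes \<open>g\<close> nonzero, so the quotients
    \<open>(c, d)\<close> are coprime and Bezout completes them to a matrix of determinant 1 with
    top row \<open>(u, - v)\<close>.\<close>
  define g where "g = gcd r s"
  obtain c d where rs: "r = c * g" "s = d * g" and "coprime c d"
    using False gcd_coprime_exists[of r s] unfolding g_def by auto
  obtain u v where "u * d + v * c = gcd d c" using bezout_int by blast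
  then have "u * d - (- v) * c = 1" using \<open>coprime c d\<close> by (simp add: gcd.commute)
  then obtain a b where ab: "a * d - b * c = 1" by blast
  let ?w = "of_int c * \<tau> + of_int d" and ?\<tau> = "(of_int a * \<tau> + of_int b) / (of_int c * \<tau> + of_int d)"
  have w0: "?w \<noteq> 0"
    using ab \<tau> by (auto simp: complex_eq_iff upper_half_plane_def)
  have z: "of_int r * \<tau> + of_int s = of_int g * ?w" by (simp add: rs algebra_simps)
  have "Z1 ?\<tau> (of_int g) = Z2 ?\<tau> (of_int g)"
    using eq moebius_in_upper_half_plane[OF ab \<tau>] by blast
  \<comment> \<open>At \<open>z = g * ?w\<close> the transformed argument is the integer
    \<open>g\<close>, and both genera carry the same nonzero automorphy factor.\<close>
  then show ?thesis
    using elliptic_genus_modular[OF Z1 ab \<tau>, of "of_int g * ?w"]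
      elliptic_genus_modular[OF Z2 ab \<tau>, of "of_int g * ?w"] w0
    unfolding z by simp
qed

text \<open>Having more than a given number of coincidences is phrased through a finite set
  \<open>S\<close>, which also covers infinitely many coincidences. The indices
  \<open>(r, s)\<close> run over representatives modulo \<open>h\<close>.\<close>

theorem proposition6p4:
  fixes h :: nat and D \<delta> :: int and Z1 Z2 :: "complex \<Rightarrow> complex \<Rightarrow> complex"
  assumes "h > 0" and "c_hat h D \<delta> \<ge> 0"
    and "elliptic_genus h D \<delta> Z1" and "constant_witten_indices h D \<delta> Z1"
    and "elliptic_genus h D \<delta> Z2" and "constant_witten_indices h D \<delta> Z2"
  shows "(\<forall>\<tau>\<in>upper_half_plane.
            (\<exists>S. finite S \<and> S \<subseteq> fundamental_parallelogram h \<tau> \<and>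
                 real (card S) > c_hat h D \<delta> * (real h)\<^sup>2 \<and> (\<forall>z\<in>S. Z1 \<tau> z = Z2 \<tau> z)) \<longrightarrow>
            (\<forall>z. Z1 \<tau> z = Z2 \<tau> z)) \<and>
         (c_hat h D \<delta> < 1 \<longrightarrow>
            (\<forall>r\<in>{0..<int h}. \<forall>s\<in>{0..<int h}.
               witten_index h D \<delta> Z1 (r, s) = witten_index h D \<delta> Z2 (r, s)) \<longrightarrow>
            (\<forall>\<tau>\<in>upper_half_plane. \<forall>z. Z1 \<tau> z = Z2 \<tau> z)) \<and>
         (c_hat h D \<delta> < 1 \<longrightarrow> chi_y_genus h D \<delta> Z1 = chi_y_genus h D \<delta> Z2 \<longrightarrow>
            (\<forall>\<tau>\<in>upper_half_plane. \<forall>z. Z1 \<tau> z = Z2 \<tau> z))"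
proof (intro conjI impI ballI allI)
  fix \<tau> z
  assume "\<tau> \<in> upper_half_plane"
    "\<exists>S. finite S \<and> S \<subseteq> fundamental_parallelogram h \<tau> \<and>
      real (card S) > c_hat h D \<delta> * (real h)\<^sup>2 \<and> (\<forall>z\<in>S. Z1 \<tau> z = Z2 \<tau> z)"
  then show "Z1 \<tau> z = Z2 \<tau> z"
    using elliptic_genus_eq_of_many_points[OF assms(1,3,5)] by blast
next
  fix \<tau> z
  assume c: "c_hat h D \<delta> < 1" and \<tau>: "\<tau> \<in> upper_half_plane"
    and W: "\<forall>r\<in>{0..<int h}. \<forall>s\<in>{0..<int h}.
      witten_index h D \<delta> Z1 (r, s) = witten_index h D \<delta> Z2 (r, s)"
  show "Z1 \<tau> z = Z2 \<tau> z"
  proof (rule elliptic_genus_eq_of_lattice_points[OF assms(1,3,5) \<tau> c])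
    fix r s assume "r \<in> {0..<int h}" "s \<in> {0..<int h}"
    with W show "Z1 \<tau> (of_int r * \<tau> + of_int s) = Z2 \<tau> (of_int r * \<tau> + of_int s)"
      unfolding twisted_genus_zero_eq_iff[of h D \<delta>, symmetric]
      by (simp add: twisted_genus_eq_witten_index[OF assms(4) \<tau>] twisted_genus_eq_witten_index[OF assms(6) \<tau>])
  qed
next
  fix \<tau> z
  assume c: "c_hat h D \<delta> < 1" and \<tau>: "\<tau> \<in> upper_half_plane"
    and chi: "chi_y_genus h D \<delta> Z1 = chi_y_genus h D \<delta> Z2"
  have chi1: "is_chi_y_genus h D \<delta> Z1 (chi_y_genus h D \<delta> Z2)"
    using is_chi_y_genus_chi_y_genus[OF assms(1,3)] chi by simp
  note chi2 = is_chi_y_genus_chi_y_genus[OF assms(1,5)]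
  \<comment> \<open>Agreement is needed at every \<open>\<tau>'\<close>, since the modular
    transformation that reaches a lattice point changes \<open>\<tau>\<close>.\<close>
  have "Z1 \<tau>' (of_int n) = Z2 \<tau>' (of_int n)" if "\<tau>' \<in> upper_half_plane" for \<tau>' n
    using elliptic_genus_at_int[OF assms(4) chi1 that] elliptic_genus_at_int[OF assms(6) chi2 that]
    by simp
  then show "Z1 \<tau> z = Z2 \<tau> z"
    by (rule elliptic_genus_eq_of_lattice_points[OF assms(1,3,5) \<tau> c
          elliptic_genus_eq_at_lattice_points[OF assms(3,5) _ \<tau>]])
qed

end
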